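(* Let $R$ be a right archimedean domain, let $(S,\leq)$ be an Artinian strictly totally ordered monoid, and let $\omega:S\to\mathrm{End}(R)$, $s\mapsto\omega_s$, be a monoid homomorphism. If for each $s\in S$ the endomorphism $\omega_s$ is injective and preserves nonunit elements of $R$ (that is, $\omega_s(r)$ is a nonunit whenever $r\in R$ is a nonunit), then the skew generalized power series ring $R[[S,\omega]]$ is a right archimedean domain.
   Context: Rings and monoids have an identity element, preserved by homomorphisms, and are not assumed commutative; in particular domains need not be commutative. $\mathrm{End}(R)$ is the monoid of (unital) ring endomorphisms of $R$. A ring $R$ is left archimedean if $\bigcap_{n\in\mathbb{N}} Rr^n=\{0\}$ for each nonunit $r\in R$, and right archimedean if $\bigcap_{n\in\mathbb{N}} r^nR=\{0\}$ for each nonunit $r\in R$. A partially ordered set is Artinian if every strictly decreasing sequence of its elements is finite, and narrow if every subset of pairwise order-incomparable elements is finite. An ordered monoid is a monoid $S$ with a partial order $\leq$ such that $a\leq b$ implies $ca\leq cb$ and $ac\leq bc$ for all $a,b,c\in S$; it is strictly ordered if $a<b$ implies $ca<cb$ and $ac<bc$ for all $a,b,c\in S$; it is strictly totally ordered if moreover $\leq$ is a total order; and an Artinian one is one whose underlying ordered set is Artinian. For a strictly ordered monoid $(S,\leq)$ and a monoid homomorphism $\omega:S\to\mathrm{End}(R)$, the skew generalized power series ring $R[[S,\omega]]$ is the set of all functions $f:S\to R$ whose support $\mathrm{supp}(f)=\{s\in S: f(s)\neq 0\}$ is Artinian and narrow, with pointwise addition and multiplication $(fg)(s)=\sum_{(u,v)\in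 X_s(f,g)} f(u)\,\omega_u(g(v))$, where $X_s(f,g)=\{(u,v)\in \mathrm{supp}(f)\times\mathrm{supp}(g): s=uv\}$, which is a finite set (an empty sum is $0$). *)

theory Defs
  imports "HOL-Algebra.Algebra"
begin

text \<open>The library's \<^locale>\<open>domain\<close> extends \<^locale>\<open>cring\<close> and hence is commutative; domains here
  are not.\<close>

locale nc_domain = ring R for R (structure) +
  assumes one_not_zero: "\<one> \<noteq> \<zero>"
    and integral: "\<lbrakk>a \<in> carrier R; b \<in> carrier R; a \<otimes> b = \<zero>\<rbrakk> \<Longrightarrow> a = \<zero> \<or> b = \<zero>"

definition right_archimedean :: "('r, 'm) ring_scheme \<Rightarrow> bool" where
  "right_archimedean R \<longleftrightarrow>
     (\<forall>r \<in> carrier R - Units R.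
        (\<Inter>n::nat. (r [^]\<^bsub>R\<^esub> n) <#\<^bsub>R\<^esub> carrier R) = {\<zero>\<^bsub>R\<^esub>})"

text \<open>Orders are given as relations, \<open>(a, b) \<in> leS\<close> meaning \<open>a \<le> b\<close>; the strict order is
  \<open>leS - Id\<close>. A subset \<open>A\<close> carries the restricted order.\<close>

definition artinian_on :: "'s set \<Rightarrow> 's rel \<Rightarrow> bool" where
  "artinian_on A leS \<longleftrightarrow>
     (\<nexists>f :: nat \<Rightarrow> 's. (\<forall>n. f n \<in> A) \<and> (\<forall>n. (f (Suc n), f n) \<in> leS - Id))"

definition narrow_on :: "'s set \<Rightarrow> 's rel \<Rightarrow> bool" where
  "narrow_on A leS \<longleftrightarrow>
     (\<forall>B \<subseteq> A. (\<forall>x \<in> B. \<forall>y \<in> B. x \<noteq> y \<longrightarrow> (x, y) \<notin> leS \<and> (y, x) \<notin> leS) \<longrightarrow> finite B)"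

locale ordered_monoid = monoid S for S (structure) +
  fixes leS :: "'a rel"
  assumes leS_partial_order: "partial_order_on (carrier S) leS"
    and le_mult_left:
      "\<lbrakk>a \<in> carrier S; b \<in> carrier S; c \<in> carrier S; (a, b) \<in> leS\<rbrakk> \<Longrightarrow> (c \<otimes> a, c \<otimes> b) \<in> leS"
    and le_mult_right:
      "\<lbrakk>a \<in> carrier S; b \<in> carrier S; c \<in> carrier S; (a, b) \<in> leS\<rbrakk> \<Longrightarrow> (a \<otimes> c, b \<otimes> c) \<in> leS"

locale strictly_ordered_monoid = ordered_monoid +
  assumes less_mult_left:
      "\<lbrakk>a \<in> carrier S; b \<in> carrier S; c \<in> carrier S; (a, b) \<in> leS - Id\<rbrakk>
        \<Longrightarrow> (c \<otimes> a, c \<otimes> b) \<in> leS - Id"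
    and less_mult_right:
      "\<lbrakk>a \<in> carrier S; b \<in> carrier S; c \<in> carrier S; (a, b) \<in> leS - Id\<rbrakk>
        \<Longrightarrow> (a \<otimes> c, b \<otimes> c) \<in> leS - Id"

locale strictly_totally_ordered_monoid = strictly_ordered_monoid +
  assumes leS_total: "total_on (carrier S) leS"

text \<open>The library's \<^const>\<open>hom\<close> does not require preservation of the identity.\<close>

definition monoid_hom :: "('a, 'm) monoid_scheme \<Rightarrow> ('b, 'n) monoid_scheme \<Rightarrow> ('a \<Rightarrow> 'b) set" where
  "monoid_hom S T = {h \<in> hom S T. h \<one>\<^bsub>S\<^esub> = \<one>\<^bsub>T\<^esub>}"

text \<open>Endomorphisms are taken extensional, so that equality in the monoid is equality of maps on
  the carrier of \<open>R\<close>.\<close>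

definition End_monoid :: "('r, 'm) ring_scheme \<Rightarrow> ('r \<Rightarrow> 'r) monoid" where
  "End_monoid R =
     \<lparr>carrier = ring_hom R R \<inter> extensional (carrier R),
      monoid.mult = compose (carrier R),
      one = \<lambda>x \<in> carrier R. x\<rparr>"

definition gsupp :: "('s, 'n) monoid_scheme \<Rightarrow> ('r, 'm) ring_scheme \<Rightarrow> ('s \<Rightarrow> 'r) \<Rightarrow> 's set" where
  "gsupp S R f = {s \<in> carrier S. f s \<noteq> \<zero>\<^bsub>R\<^esub>}"

definition gX :: "('s, 'n) monoid_scheme \<Rightarrow> ('r, 'm) ring_scheme \<Rightarrow> 's
    \<Rightarrow> ('s \<Rightarrow> 'r) \<Rightarrow> ('s \<Rightarrow> 'r) \<Rightarrow> ('s \<times> 's) set" where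
  "gX S R s f g = {(u, v) \<in> gsupp S R f \<times> gsupp S R g. s = u \<otimes>\<^bsub>S\<^esub> v}"

text \<open>\<^const>\<open>finsum\<close> over an infinite set is zero by convention; for a strictly ordered monoid and
  \<open>f\<close>, \<open>g\<close> in the carrier the index set below is finite, so the convention is not used.\<close>

definition skew_gps :: "('s, 'n) monoid_scheme \<Rightarrow> 's rel \<Rightarrow> ('r, 'm) ring_scheme
    \<Rightarrow> ('s \<Rightarrow> 'r \<Rightarrow> 'r) \<Rightarrow> ('s \<Rightarrow> 'r) ring" where
  "skew_gps S leS R \<omega> =
     \<lparr>carrier = {f \<in> carrier S \<rightarrow>\<^sub>E carrier R.
                  artinian_on (gsupp S R f) leS \<and> narrow_on (gsupp S R f) leS},
      monoid.mult = (\<lambda>f g. \<lambda>s \<in> carrier S.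
                finsum R (\<lambda>(u, v). f u \<otimes>\<^bsub>R\<^esub> \<omega> u (g v)) (gX S R s f g)),
      one = (\<lambda>s \<in> carrier S. if s = \<one>\<^bsub>S\<^esub> then \<one>\<^bsub>R\<^esub> else \<zero>\<^bsub>R\<^esub>),
      ring.zero = (\<lambda>s \<in> carrier S. \<zero>\<^bsub>R\<^esub>),
      ring.add = (\<lambda>f g. \<lambda>s \<in> carrier S. f s \<oplus>\<^bsub>R\<^esub> g s)\<rparr>"

end

theory Submission
  imports Defs
begin

text \<open>The order on \<open>S\<close> is Artinian and total, hence a well-order, and \<open>\<one>\<close> is its least element:
  the powers of an element below \<open>\<one>\<close> would descend forever. Consequently every function
  \<open>S \<rightarrow> R\<close> is a series, every element of \<open>S\<close> has only finitely many factorizations into two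
  factors (so that multiplication is associative by regrouping a finite sum), and every nonzero
  series has a leading term, namely the one at the least element of its support. Strict
  monotonicity makes leading terms multiplicative up to the twist: if \<open>f\<close> and \<open>g\<close> start at \<open>p\<close>
  and \<open>q\<close>, then \<open>f \<otimes> g\<close> starts at \<open>p \<otimes> q\<close> with coefficient \<open>f p \<otimes> \<omega> p (g q)\<close>
  (\<open>leading_term\<close>). Injectivity of the \<open>\<omega> p\<close> makes this coefficient nonzero over a domain, so the
  series form a domain (\<open>nc_domain_A\<close>).

  For the archimedean property, let \<open>f\<close> be a nonunit series and \<open>g \<noteq> \<zero>\<close> a right multiple of all
  powers of \<open>f\<close>, with cofactors \<open>h n\<close>. Cancelling \<open>f [^] n\<close> gives \<open>h n = f \<otimes> h (Suc n)\<close>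
  (\<open>chain_of_cofactors\<close>). If \<open>f\<close> starts above \<open>\<one>\<close>, the starting points of the \<open>h n\<close> strictly
  decrease, contradicting well-foundedness. If \<open>f\<close> starts at \<open>\<one>\<close>, all \<open>h n\<close> start at the same
  point as \<open>g\<close>, and the leading coefficient of \<open>g\<close> lies in \<open>(f \<one>) [^] n \<otimes> R\<close> for all \<open>n\<close>. This
  contradicts the archimedean property of \<open>R\<close>, because \<open>f \<one>\<close> is a nonunit of \<open>R\<close>: a series
  whose coefficient at \<open>\<one>\<close> is a unit can be inverted by recursion along the well-order
  (\<open>Units_A_if_coeff_one_unit\<close>).\<close>

section \<open>Well-ordered monoids\<close>

text \<open>A nonempty set has a greatest element \<open>m\<close>, and hence is finite once the set of elements below
  \<open>m\<close> is. This applies first to the sets of elements below a given one, by induction, and then to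
  \<open>A\<close> itself.\<close>

lemma finite_if_wf_both_directions:
  assumes wf: "wf r" and wf_conv: "wf (r\<inverse>)" and total: "total_on A r"
  shows "finite A"
proof -
  have greatest: "finite B"
    if "B \<subseteq> A" and below: "\<And>m. m \<in> B \<Longrightarrow> finite {y \<in> A. (y, m) \<in> r}" for B
  proof (cases "B = {}")
    case False
    then obtain m where m: "m \<in> B" "\<And>y. (y, m) \<in> r\<inverse> \<Longrightarrow> y \<notin> B"
      using wfE_min'[OF wf_conv, of B] by blast
    have "B \<subseteq> insert m {y \<in> A. (y, m) \<in> r}"
      using m \<open>B \<subseteq> A\<close> total by (fastforce simp: total_on_def)
    then show ?thesis using below[OF m(1)] finite_subset by blast
  qed simp
  have "finite {y \<in> A. (y, x) \<in> r}" for x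
    using wf by (induction x rule: wf_induct_rule) (rule greatest, auto)
  then show ?thesis by (rule greatest[OF order_refl])
qed

locale well_ordered_monoid = strictly_totally_ordered_monoid S leS
  for S :: "('s, 'n) monoid_scheme" (structure) and leS :: "'s rel" +
  assumes artinian: "artinian_on (carrier S) leS"
begin

abbreviation less :: "'s \<Rightarrow> 's \<Rightarrow> bool" (infix "\<lless>" 50) where
  "a \<lless> b \<equiv> (a, b) \<in> leS - Id"

lemma less_carrier: "a \<lless> b \<Longrightarrow> a \<in> carrier S \<and> b \<in> carrier S"
  using partial_order_onD(4)[OF leS_partial_order] by auto

lemma less_trans: "a \<lless> b \<Longrightarrow> b \<lless> c \<Longrightarrow> a \<lless> c"
  using partial_order_onD(2,3)[OF leS_partial_order] by (auto dest: transD antisymD)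

lemma less_cases:
  assumes "a \<in> carrier S" "b \<in> carrier S"
  obtains "a \<lless> b" | "a = b" | "b \<lless> a"
  using assms leS_total by (auto simp: total_on_def)

lemma wf_less: "wf (leS - Id)"
  unfolding wf_iff_no_infinite_down_chain
proof
  assume "\<exists>f. \<forall>i. (f (Suc i), f i) \<in> leS - Id"
  then obtain f where f: "f (Suc i) \<lless> f i" for i by blast
  then have "f i \<in> carrier S" for i using less_carrier by blast
  with f artinian show False unfolding artinian_on_def by blast
qed

lemma not_less_sym: "a \<lless> b \<Longrightarrow> \<not> b \<lless> a"
  using wf_not_sym[OF wf_less] .

text \<open>If \<open>s \<lless> \<one>\<close>, the powers of \<open>s\<close> would form an infinite strictly decreasing sequence.\<close>

lemma not_less_one: "\<not> s \<lless> \<one>"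
proof
  assume s: "s \<lless> \<one>"
  then have [simp]: "s \<in> carrier S" using less_carrier by blast
  have "s [^] Suc i \<lless> s [^] i" for i :: nat
    using less_mult_left[OF _ _ _ s, of "s [^] i"] by simp
  then show False
    using wf_less unfolding wf_iff_no_infinite_down_chain by blast
qed

lemma mult_less_mono:
  assumes "u \<in> carrier S" "v \<in> carrier S" "p \<in> carrier S" "q \<in> carrier S"
    and "\<not> u \<lless> p" "\<not> v \<lless> q"
  shows "u \<otimes> v = p \<otimes> q \<and> u = p \<and> v = q \<or> p \<otimes> q \<lless> u \<otimes> v"
proof -
  have 1: "p \<otimes> q \<lless> u \<otimes> q \<or> u = p"
    using assms less_mult_right[of p u q] less_cases[of u p] by blast
  have 2: "u \<otimes> q \<lless> u \<otimes> v \<or> v = q"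
    using assms less_mult_left[of q v u] less_cases[of v q] by blast
  show ?thesis using 1 2 less_trans[of "p \<otimes> q" "u \<otimes> q" "u \<otimes> v"] by blast
qed

lemma mult_left_cancel:
  assumes "u \<in> carrier S" "v \<in> carrier S" "w \<in> carrier S" "u \<otimes> v = u \<otimes> w"
  shows "v = w"
  using assms(2,3)
proof (cases rule: less_cases)
  assume "v \<lless> w"
  then show ?thesis using less_mult_left[of v w u] assms by simp
next
  assume "w \<lless> v"
  then show ?thesis using less_mult_left[of w v u] assms by simp
qed

lemma less_mult_if_not_one:
  assumes "s \<in> carrier S" "t \<in> carrier S" "s \<noteq> \<one>"
  shows "t \<lless> s \<otimes> t"
proof -
  have "\<one> \<lless> s" using less_cases[of s \<one>] not_less_one assms by blast
  then show ?thesis using less_mult_right[of \<one> s t] assms by simp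
qed

definition factorizations :: "'s \<Rightarrow> ('s \<times> 's) set" where
  "factorizations s = {(u, v) \<in> carrier S \<times> carrier S. s = u \<otimes> v}"

lemma in_factorizations:
  "(u, v) \<in> factorizations s \<longleftrightarrow> u \<in> carrier S \<and> v \<in> carrier S \<and> s = u \<otimes> v"
  by (auto simp: factorizations_def)

lemma mem_factorizations:
  "p \<in> factorizations s \<longleftrightarrow> fst p \<in> carrier S \<and> snd p \<in> carrier S \<and> s = fst p \<otimes> snd p"
  by (cases p) (simp add: in_factorizations)

text \<open>A larger left factor forces a smaller right factor, so ordering the factorizations by their
  left factors gives a well-order whose reverse is a well-order too.\<close>

lemma finite_factorizations: "finite (factorizations s)"
proof -
  let ?r = "{(p, q) \<in> factorizations s \<times> factorizations s. fst p \<lless> fst q}"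
  have snd_antimono: "v' \<lless> v"
    if "(u, v) \<in> factorizations s" "(u', v') \<in> factorizations s" "u \<lless> u'" for u v u' v'
  proof (rule ccontr)
    assume "\<not> v' \<lless> v"
    moreover have "\<not> u' \<lless> u" "u' \<noteq> u"
      using not_less_sym[OF that(3)] that(3) by blast+
    ultimately have "u \<otimes> v \<lless> u' \<otimes> v'"
      using that(1,2) mult_less_mono[of u' v' u v] unfolding in_factorizations by blast
    then show False using that(1,2) unfolding in_factorizations by simp
  qed
  have "wf ?r"
    by (rule wf_subset[OF wf_inv_image[OF wf_less, of fst]]) (auto simp: inv_image_def)
  moreover have "wf (?r\<inverse>)"
    by (rule wf_subset[OF wf_inv_image[OF wf_less, of snd]])
      (use snd_antimono in \<open>fastforce simp: inv_image_def\<close>)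
  moreover have "total_on (factorizations s) ?r"
  proof (rule total_onI)
    fix p q assume *: "p \<in> factorizations s" "q \<in> factorizations s" "p \<noteq> q"
    then have "fst p \<noteq> fst q"
      using mult_left_cancel by (metis in_factorizations prod.collapse)
    with * show "(p, q) \<in> ?r \<or> (q, p) \<in> ?r"
      using less_cases[of "fst p" "fst q"] by (cases p, cases q) (simp add: in_factorizations, blast)
  qed
  ultimately show ?thesis by (rule finite_if_wf_both_directions)
qed

lemma artinian_on_subset: "A \<subseteq> carrier S \<Longrightarrow> artinian_on A leS"
  using artinian unfolding artinian_on_def by blast

lemma narrow_on_subset:
  assumes "A \<subseteq> carrier S"
  shows "narrow_on A leS"
  unfolding narrow_on_def
proof (intro allI impI)
  fix B assume B: "B \<subseteq> A"
    and "\<forall>x\<in>B. \<forall>y\<in>B. x \<noteq> y \<longrightarrow> (x, y) \<notin> leS \<and> (y, x) \<notin> leS"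
  then have *: "x = y" if "x \<in> B" "y \<in> B" for x y
    using that assms leS_total unfolding total_on_def by blast
  show "finite B"
  proof (cases "B = {}")
    case False
    then obtain x where "x \<in> B" by blast
    with * have "B = {x}" by blast
    then show ?thesis by simp
  qed simp
qed

end

section \<open>Generalities on rings\<close>

lemma (in abelian_monoid) finsum_Sigma:
  assumes "finite I" "\<And>i. i \<in> I \<Longrightarrow> finite (A i)"
    and "\<And>i x. i \<in> I \<Longrightarrow> x \<in> A i \<Longrightarrow> g i x \<in> carrier G"
  shows "(\<Oplus>i\<in>I. \<Oplus>x\<in>A i. g i x) = finsum G (\<lambda>(i, x). g i x) (Sigma I A)"
proof -
  have "finsum G (\<lambda>(i, x). g i x) (Sigma I A) = finsum G (\<lambda>(i, x). g i x) (\<Union>i\<in>I. Pair i ` A i)"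
    by (rule arg_cong[where f = "finsum G _"]) auto
  also have "\<dots> = (\<Oplus>i\<in>I. finsum G (\<lambda>(i, x). g i x) (Pair i ` A i))"
    using assms by (intro add.finprod_UN_disjoint) (auto simp: pairwise_def disjnt_def)
  also have "\<dots> = (\<Oplus>i\<in>I. \<Oplus>x\<in>A i. g i x)"
  proof (rule finsum_cong')
    fix i assume i: "i \<in> I"
    show "finsum G (\<lambda>(i, x). g i x) (Pair i ` A i) = (\<Oplus>x\<in>A i. g i x)"
      using assms(3) i by (subst finsum_reindex) (auto simp: inj_on_def)
  qed (use assms in \<open>auto intro!: finsum_closed\<close>)
  finally show ?thesis ..
qed

lemma (in abelian_monoid) finsum_single_term:
  assumes "finite A" "a \<in> A" "h a \<in> carrier G" "\<And>x. x \<in> A \<Longrightarrow> x \<noteq> a \<Longrightarrow> h x = \<zero>"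
  shows "finsum G h A = h a"
proof -
  have "finsum G h {a} = finsum G h A"
    using assms by (intro add.finprod_mono_neutral_cong_left) (auto, metis zero_closed)
  then show ?thesis using assms by simp
qed

context nc_domain
begin

lemma nat_pow_nonzero:
  assumes "a \<in> carrier R" "a \<noteq> \<zero>"
  shows "a [^] (n :: nat) \<noteq> \<zero>"
  using assms one_not_zero by (induction n) (auto dest: integral[rotated 2])

lemma mult_left_cancel:
  assumes "a \<in> carrier R" "a \<noteq> \<zero>" "x \<in> carrier R" "y \<in> carrier R" "a \<otimes> x = a \<otimes> y"
  shows "x = y"
proof -
  have "a \<otimes> (x \<ominus> y) = \<zero>"
    using assms by (simp add: a_minus_def r_distr r_minus r_neg)
  then have "x \<ominus> y = \<zero>" using assms integral[of a "x \<ominus> y"] by auto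
  then show ?thesis using assms by simp
qed

text \<open>The cofactors \<open>h n\<close> in \<open>x = a [^] n \<otimes> h n\<close> are linked because \<open>a [^] n\<close> can be cancelled.\<close>

lemma chain_of_cofactors:
  assumes a: "a \<in> carrier R" "a \<noteq> \<zero>"
    and x: "x \<in> (\<Inter>n::nat. (a [^] n) <# carrier R)"
  obtains h where "h 0 = x" and "\<And>n :: nat. h n \<in> carrier R" and "\<And>n. h n = a \<otimes> h (Suc n)"
proof -
  have "\<forall>n. \<exists>y \<in> carrier R. x = a [^] (n :: nat) \<otimes> y"
    using x by (auto simp: l_coset_def)
  then obtain h where h: "h n \<in> carrier R" "x = a [^] n \<otimes> h n" for n :: nat by metis
  have "h n = a \<otimes> h (Suc n)" for n
  proof (rule mult_left_cancel)
    show "a [^] n \<otimes> h n = a [^] n \<otimes> (a \<otimes> h (Suc n))"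
      using h(2)[of n] h(2)[of "Suc n"] a h(1) by (simp add: m_assoc)
  qed (use a h(1) nat_pow_nonzero in auto)
  moreover have "h 0 = x" using h[of 0] by simp
  ultimately show ?thesis using that h(1) by blast
qed

end

section \<open>The skew series ring over a well-ordered monoid\<close>

locale skew_series = R: ring R + S: well_ordered_monoid S leS
  for R :: "('r, 'm) ring_scheme" (structure) and S :: "('s, 'n) monoid_scheme" (structure)
    and leS :: "'s rel" +
  fixes \<omega> :: "'s \<Rightarrow> 'r \<Rightarrow> 'r"
  assumes omega_hom: "\<omega> \<in> monoid_hom S (End_monoid R)"
begin

abbreviation A where "A \<equiv> skew_gps S leS R \<omega>"

lemma omega_ring_hom: "s \<in> carrier S \<Longrightarrow> \<omega> s \<in> ring_hom R R"
  using omega_hom by (auto simp: monoid_hom_def End_monoid_def hom_def)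

lemma omega_closed [simp]: "s \<in> carrier S \<Longrightarrow> r \<in> carrier R \<Longrightarrow> \<omega> s r \<in> carrier R"
  using ring_hom_closed[OF omega_ring_hom] .

lemma omega_mult [simp]:
  "\<lbrakk>s \<in> carrier S; r \<in> carrier R; r' \<in> carrier R\<rbrakk> \<Longrightarrow> \<omega> s (r \<otimes> r') = \<omega> s r \<otimes> \<omega> s r'"
  using ring_hom_mult[OF omega_ring_hom] .

lemma omega_add [simp]:
  "\<lbrakk>s \<in> carrier S; r \<in> carrier R; r' \<in> carrier R\<rbrakk> \<Longrightarrow> \<omega> s (r \<oplus> r') = \<omega> s r \<oplus> \<omega> s r'"
  using ring_hom_add[OF omega_ring_hom] .

lemma omega_one [simp]: "s \<in> carrier S \<Longrightarrow> \<omega> s \<one> = \<one>"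
  using ring_hom_one[OF omega_ring_hom] .

lemma omega_zero [simp]: "s \<in> carrier S \<Longrightarrow> \<omega> s \<zero> = \<zero>"
  using ring_hom_zero[OF omega_ring_hom R.ring_axioms R.ring_axioms] .

lemma omega_at_one [simp]: "r \<in> carrier R \<Longrightarrow> \<omega> \<one>\<^bsub>S\<^esub> r = r"
  using omega_hom by (auto simp: monoid_hom_def End_monoid_def)

lemma omega_at_mult:
  "\<lbrakk>s \<in> carrier S; t \<in> carrier S; r \<in> carrier R\<rbrakk> \<Longrightarrow> \<omega> (s \<otimes>\<^bsub>S\<^esub> t) r = \<omega> s (\<omega> t r)"
  using omega_hom by (auto simp: monoid_hom_def End_monoid_def hom_def compose_def)

lemma omega_finsum:
  assumes "s \<in> carrier S" "g \<in> I \<rightarrow> carrier R"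
  shows "\<omega> s (finsum R g I) = (\<Oplus>i\<in>I. \<omega> s (g i))"
  using assms(2)
  by (induction I rule: infinite_finite_induct) (auto simp: assms(1) Pi_def)

text \<open>In a well-ordered set every subset is Artinian and narrow, so the support condition
  disappears.\<close>

lemma carrier_A: "carrier A = carrier S \<rightarrow>\<^sub>E carrier R"
proof -
  have "gsupp S R f \<subseteq> carrier S" for f by (auto simp: gsupp_def)
  then show ?thesis
    by (auto simp: skew_gps_def intro: S.artinian_on_subset S.narrow_on_subset)
qed

lemma A_apply [simp]: "f \<in> carrier A \<Longrightarrow> s \<in> carrier S \<Longrightarrow> f s \<in> carrier R"
  by (auto simp: carrier_A)

lemma A_eqI:
  "\<lbrakk>f \<in> carrier A; g \<in> carrier A; \<And>s. s \<in> carrier S \<Longrightarrow> f s = g s\<rbrakk> \<Longrightarrow> f = g"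
  unfolding carrier_A by (rule PiE_ext)

lemma zero_A [simp]: "s \<in> carrier S \<Longrightarrow> \<zero>\<^bsub>A\<^esub> s = \<zero>"
  by (simp add: skew_gps_def)

lemma one_A [simp]: "s \<in> carrier S \<Longrightarrow> \<one>\<^bsub>A\<^esub> s = (if s = \<one>\<^bsub>S\<^esub> then \<one> else \<zero>)"
  by (simp add: skew_gps_def)

lemma add_A [simp]: "s \<in> carrier S \<Longrightarrow> (f \<oplus>\<^bsub>A\<^esub> g) s = f s \<oplus> g s"
  by (simp add: skew_gps_def)

text \<open>Summing over all factorizations instead of those inside the supports makes the index set
  independent of the series; the additional terms vanish.\<close>

lemma mult_A:
  assumes "f \<in> carrier A" "g \<in> carrier A" "s \<in> carrier S"
  shows "(f \<otimes>\<^bsub>A\<^esub> g) s = finsum R (\<lambda>(u, v). f u \<otimes> \<omega> u (g v)) (S.factorizations s)"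
proof -
  have "(f \<otimes>\<^bsub>A\<^esub> g) s = finsum R (\<lambda>(u, v). f u \<otimes> \<omega> u (g v)) (gX S R s f g)"
    using assms by (simp add: skew_gps_def)
  also have "\<dots> = finsum R (\<lambda>(u, v). f u \<otimes> \<omega> u (g v)) (S.factorizations s)"
  proof (rule R.add.finprod_mono_neutral_cong_left)
    show "gX S R s f g \<subseteq> S.factorizations s"
      by (auto simp: gX_def gsupp_def S.in_factorizations)
    show "(\<lambda>(u, v). f u \<otimes> \<omega> u (g v)) \<in> S.factorizations s \<rightarrow> carrier R"
      using assms by (auto simp: S.in_factorizations)
    show "(case i of (u, v) \<Rightarrow> f u \<otimes> \<omega> u (g v)) = \<zero>"
      if "i \<in> S.factorizations s - gX S R s f g" for i
      using that assms by (auto simp: gX_def gsupp_def S.in_factorizations)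
  qed (simp_all add: S.finite_factorizations)
  finally show ?thesis .
qed

lemma A_closed [simp]:
  shows "\<zero>\<^bsub>A\<^esub> \<in> carrier A" "\<one>\<^bsub>A\<^esub> \<in> carrier A"
    and "\<lbrakk>f \<in> carrier A; g \<in> carrier A\<rbrakk> \<Longrightarrow> f \<oplus>\<^bsub>A\<^esub> g \<in> carrier A"
    and "\<lbrakk>f \<in> carrier A; g \<in> carrier A\<rbrakk> \<Longrightarrow> f \<otimes>\<^bsub>A\<^esub> g \<in> carrier A"
proof -
  show "\<zero>\<^bsub>A\<^esub> \<in> carrier A" "\<one>\<^bsub>A\<^esub> \<in> carrier A"
    unfolding carrier_A by (auto simp: skew_gps_def)
  show "f \<oplus>\<^bsub>A\<^esub> g \<in> carrier A" if "f \<in> carrier A" "g \<in> carrier A"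
    using that unfolding carrier_A by (auto simp: skew_gps_def)
  assume fg: "f \<in> carrier A" "g \<in> carrier A"
  have "(f \<otimes>\<^bsub>A\<^esub> g) s \<in> carrier R" if "s \<in> carrier S" for s
    unfolding mult_A[OF fg that] using fg
    by (intro R.finsum_closed) (auto simp: S.in_factorizations)
  moreover have "f \<otimes>\<^bsub>A\<^esub> g \<in> extensional (carrier S)"
    by (simp add: skew_gps_def)
  ultimately show "f \<otimes>\<^bsub>A\<^esub> g \<in> carrier A"
    unfolding carrier_A by (auto simp: PiE_def)
qed

text \<open>Both bracketings are sums over the factorizations of \<open>s\<close> into three factors: going from one
  to the other is the bijection regrouping \<open>(a \<otimes> b) \<otimes> c\<close> as \<open>a \<otimes> (b \<otimes> c)\<close>.\<close>

lemma A_assoc: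
  assumes f: "f \<in> carrier A" and g: "g \<in> carrier A" and h: "h \<in> carrier A"
  shows "(f \<otimes>\<^bsub>A\<^esub> g) \<otimes>\<^bsub>A\<^esub> h = f \<otimes>\<^bsub>A\<^esub> (g \<otimes>\<^bsub>A\<^esub> h)"
proof (rule A_eqI)
  fix s assume s: "s \<in> carrier S"
  note [simp] = f g h S.mem_factorizations S.finite_factorizations
  let ?F = "S.factorizations"
  let ?t = "\<lambda>a b c. f a \<otimes> \<omega> a (g b) \<otimes> \<omega> a (\<omega> b (h c))"
  let ?L = "Sigma (?F s) (\<lambda>p. ?F (fst p))" and ?R = "Sigma (?F s) (\<lambda>p. ?F (snd p))"
  let ?l = "\<lambda>z. ?t (fst (snd z)) (snd (snd z)) (snd (fst z))"
  let ?r = "\<lambda>z. ?t (fst (fst z)) (fst (snd z)) (snd (snd z))"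
  let ?j = "\<lambda>z. ((fst (snd z), snd (snd z) \<otimes>\<^bsub>S\<^esub> snd (fst z)), (snd (snd z), snd (fst z)))"
  have left: "(f \<otimes>\<^bsub>A\<^esub> g) w \<otimes> \<omega> w (h c) = (\<Oplus>q\<in>?F w. ?t (fst q) (snd q) c)"
    if w: "w \<in> carrier S" "c \<in> carrier S" for w c
  proof -
    have "(f \<otimes>\<^bsub>A\<^esub> g) w \<otimes> \<omega> w (h c)
        = (\<Oplus>q\<in>?F w. f (fst q) \<otimes> \<omega> (fst q) (g (snd q)) \<otimes> \<omega> w (h c))"
      unfolding mult_A[OF f g w(1)] case_prod_unfold using w
      by (intro R.finsum_ldistr) auto
    also have "\<dots> = (\<Oplus>q\<in>?F w. ?t (fst q) (snd q) c)"
      using w by (intro R.finsum_cong') (auto simp: omega_at_mult)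
    finally show ?thesis .
  qed
  have right: "f a \<otimes> \<omega> a ((g \<otimes>\<^bsub>A\<^esub> h) w) = (\<Oplus>q\<in>?F w. ?t a (fst q) (snd q))"
    if w: "w \<in> carrier S" "a \<in> carrier S" for w a
  proof -
    have "f a \<otimes> \<omega> a ((g \<otimes>\<^bsub>A\<^esub> h) w)
        = f a \<otimes> (\<Oplus>q\<in>?F w. \<omega> a (g (fst q) \<otimes> \<omega> (fst q) (h (snd q))))"
      unfolding mult_A[OF g h w(1)] case_prod_unfold using w by (subst omega_finsum) auto
    also have "\<dots> = (\<Oplus>q\<in>?F w. f a \<otimes> \<omega> a (g (fst q) \<otimes> \<omega> (fst q) (h (snd q))))"
      using w by (intro R.finsum_rdistr) auto
    also have "\<dots> = (\<Oplus>q\<in>?F w. ?t a (fst q) (snd q))"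
      using w by (intro R.finsum_cong') (auto simp: R.m_assoc)
    finally show ?thesis .
  qed
  have "((f \<otimes>\<^bsub>A\<^esub> g) \<otimes>\<^bsub>A\<^esub> h) s
      = (\<Oplus>p\<in>?F s. (f \<otimes>\<^bsub>A\<^esub> g) (fst p) \<otimes> \<omega> (fst p) (h (snd p)))"
    using s by (simp add: mult_A case_prod_unfold)
  also have "\<dots> = (\<Oplus>p\<in>?F s. \<Oplus>q\<in>?F (fst p). ?t (fst q) (snd q) (snd p))"
    by (rule R.finsum_cong') (auto simp: left intro!: R.finsum_closed)
  also have "\<dots> = finsum R ?l ?L"
    by (subst R.finsum_Sigma) (auto simp: case_prod_unfold)
  also have "\<dots> = (\<Oplus>z\<in>?L. ?r (?j z))"
    by simp
  also have "\<dots> = finsum R ?r (?j ` ?L)"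
    by (rule R.finsum_reindex[symmetric]) (auto simp: inj_on_def)
  also have "?j ` ?L = ?R"
  proof
    show "?j ` ?L \<subseteq> ?R" by (auto simp: S.m_assoc)
    show "?R \<subseteq> ?j ` ?L"
    proof
      fix x assume x: "x \<in> ?R"
      obtain a w b c where abc: "x = ((a, w), (b, c))" by (metis surj_pair)
      with x have "x = ?j ((a \<otimes>\<^bsub>S\<^esub> b, c), (a, b))" "((a \<otimes>\<^bsub>S\<^esub> b, c), (a, b)) \<in> ?L"
        by (auto simp: S.m_assoc)
      then show "x \<in> ?j ` ?L" by (rule image_eqI)
    qed
  qed
  also have "finsum R ?r ?R = (\<Oplus>p\<in>?F s. \<Oplus>q\<in>?F (snd p). ?t (fst p) (fst q) (snd q))"
    by (subst R.finsum_Sigma) (auto simp: case_prod_unfold)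
  also have "\<dots> = (\<Oplus>p\<in>?F s. f (fst p) \<otimes> \<omega> (fst p) ((g \<otimes>\<^bsub>A\<^esub> h) (snd p)))"
    by (rule R.finsum_cong') (auto simp: right)
  also have "\<dots> = (f \<otimes>\<^bsub>A\<^esub> (g \<otimes>\<^bsub>A\<^esub> h)) s"
    using s by (simp add: mult_A case_prod_unfold)
  finally show "((f \<otimes>\<^bsub>A\<^esub> g) \<otimes>\<^bsub>A\<^esub> h) s = (f \<otimes>\<^bsub>A\<^esub> (g \<otimes>\<^bsub>A\<^esub> h)) s" .
qed (simp_all add: f g h)

text \<open>The lowest possible position \<open>p \<otimes> q\<close> of a term of the product can only be reached from the
  positions \<open>p\<close> and \<open>q\<close>, by strict monotonicity.\<close>

lemma leading_term:
  assumes f: "f \<in> carrier A" and g: "g \<in> carrier A"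
    and p: "p \<in> carrier S" "\<And>x. S.less x p \<Longrightarrow> f x = \<zero>"
    and q: "q \<in> carrier S" "\<And>x. S.less x q \<Longrightarrow> g x = \<zero>"
  shows "(f \<otimes>\<^bsub>A\<^esub> g) (p \<otimes>\<^bsub>S\<^esub> q) = f p \<otimes> \<omega> p (g q)"
    and "S.less z (p \<otimes>\<^bsub>S\<^esub> q) \<Longrightarrow> (f \<otimes>\<^bsub>A\<^esub> g) z = \<zero>"
proof -
  have vanish: "f u \<otimes> \<omega> u (g v) = \<zero>"
    if uv: "u \<in> carrier S" "v \<in> carrier S" "(u, v) \<noteq> (p, q)"
      and not_above: "\<not> S.less (p \<otimes>\<^bsub>S\<^esub> q) (u \<otimes>\<^bsub>S\<^esub> v)" for u v
  proof -
    have "S.less u p \<or> S.less v q"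
      using S.mult_less_mono[OF uv(1,2) p(1) q(1)] uv(3) not_above by blast
    then have "f u = \<zero> \<or> g v = \<zero>" using p(2) q(2) by blast
    then show ?thesis using uv(1,2) f g by auto
  qed
  have "finsum R (\<lambda>(u, v). f u \<otimes> \<omega> u (g v)) (S.factorizations (p \<otimes>\<^bsub>S\<^esub> q))
      = (case (p, q) of (u, v) \<Rightarrow> f u \<otimes> \<omega> u (g v))"
  proof (rule R.finsum_single_term)
    fix x assume x: "x \<in> S.factorizations (p \<otimes>\<^bsub>S\<^esub> q)" "x \<noteq> (p, q)"
    obtain u v where uv: "x = (u, v)" by force
    have "f u \<otimes> \<omega> u (g v) = \<zero>"
      using x unfolding uv S.in_factorizations by (intro vanish) auto
    then show "(case x of (u, v) \<Rightarrow> f u \<otimes> \<omega> u (g v)) = \<zero>" by (simp add: uv)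
  qed (use f g p(1) q(1) in \<open>simp_all add: S.finite_factorizations S.in_factorizations\<close>)
  then show "(f \<otimes>\<^bsub>A\<^esub> g) (p \<otimes>\<^bsub>S\<^esub> q) = f p \<otimes> \<omega> p (g q)"
    using f g p(1) q(1) by (simp add: mult_A)
  assume z: "S.less z (p \<otimes>\<^bsub>S\<^esub> q)"
  then have zS: "z \<in> carrier S" using S.less_carrier by blast
  have "finsum R (\<lambda>(u, v). f u \<otimes> \<omega> u (g v)) (S.factorizations z) = \<zero>"
  proof (rule R.add.finprod_one_eqI)
    fix x assume x: "x \<in> S.factorizations z"
    obtain u v where uv: "x = (u, v)" by force
    have "f u \<otimes> \<omega> u (g v) = \<zero>"
    proof (rule vanish)
      show "u \<in> carrier S" "v \<in> carrier S"
        using x by (simp_all add: uv S.in_factorizations)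
      have "S.less (u \<otimes>\<^bsub>S\<^esub> v) (p \<otimes>\<^bsub>S\<^esub> q)"
        using x z unfolding uv S.in_factorizations by blast
      then show "\<not> S.less (p \<otimes>\<^bsub>S\<^esub> q) (u \<otimes>\<^bsub>S\<^esub> v)" "(u, v) \<noteq> (p, q)"
        using S.not_less_sym by blast+
    qed
    then show "(case x of (u, v) \<Rightarrow> f u \<otimes> \<omega> u (g v)) = \<zero>" by (simp add: uv)
  qed
  then show "(f \<otimes>\<^bsub>A\<^esub> g) z = \<zero>" using f g zS by (simp add: mult_A)
qed

lemma A_one_left:
  assumes f: "f \<in> carrier A"
  shows "\<one>\<^bsub>A\<^esub> \<otimes>\<^bsub>A\<^esub> f = f"
proof (rule A_eqI)
  fix s assume s: "s \<in> carrier S"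
  have "finsum R (\<lambda>(u, v). \<one>\<^bsub>A\<^esub> u \<otimes> \<omega> u (f v)) (S.factorizations s)
      = (case (\<one>\<^bsub>S\<^esub>, s) of (u, v) \<Rightarrow> \<one>\<^bsub>A\<^esub> u \<otimes> \<omega> u (f v))"
    using s f
    by (intro R.finsum_single_term)
      (auto simp: S.finite_factorizations S.in_factorizations split: if_splits)
  then show "(\<one>\<^bsub>A\<^esub> \<otimes>\<^bsub>A\<^esub> f) s = f s" using s f by (simp add: mult_A)
qed (use f in auto)

lemma A_one_right:
  assumes f: "f \<in> carrier A"
  shows "f \<otimes>\<^bsub>A\<^esub> \<one>\<^bsub>A\<^esub> = f"
proof (rule A_eqI)
  fix s assume s: "s \<in> carrier S"
  have "finsum R (\<lambda>(u, v). f u \<otimes> \<omega> u (\<one>\<^bsub>A\<^esub> v)) (S.factorizations s)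
      = (case (s, \<one>\<^bsub>S\<^esub>) of (u, v) \<Rightarrow> f u \<otimes> \<omega> u (\<one>\<^bsub>A\<^esub> v))"
    using s f
    by (intro R.finsum_single_term)
      (auto simp: S.finite_factorizations S.in_factorizations split: if_splits)
  then show "(f \<otimes>\<^bsub>A\<^esub> \<one>\<^bsub>A\<^esub>) s = f s" using s f by (simp add: mult_A)
qed (use f in auto)

lemma A_distrib:
  assumes f: "f \<in> carrier A" and g: "g \<in> carrier A" and h: "h \<in> carrier A"
  shows "(f \<oplus>\<^bsub>A\<^esub> g) \<otimes>\<^bsub>A\<^esub> h = f \<otimes>\<^bsub>A\<^esub> h \<oplus>\<^bsub>A\<^esub> g \<otimes>\<^bsub>A\<^esub> h" (is ?left)
    and "h \<otimes>\<^bsub>A\<^esub> (f \<oplus>\<^bsub>A\<^esub> g) = h \<otimes>\<^bsub>A\<^esub> f \<oplus>\<^bsub>A\<^esub> h \<otimes>\<^bsub>A\<^esub> g" (is ?right)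
proof -
  note [simp] = f g h S.mem_factorizations
  show ?left
  proof (rule A_eqI)
    fix s assume s: "s \<in> carrier S"
    have "((f \<oplus>\<^bsub>A\<^esub> g) \<otimes>\<^bsub>A\<^esub> h) s
        = (\<Oplus>q\<in>S.factorizations s. f (fst q) \<otimes> \<omega> (fst q) (h (snd q))
            \<oplus> g (fst q) \<otimes> \<omega> (fst q) (h (snd q)))"
      unfolding mult_A[OF A_closed(3)[OF f g] h s] case_prod_unfold
      by (rule R.finsum_cong') (auto simp: R.l_distr)
    also have "\<dots> = (f \<otimes>\<^bsub>A\<^esub> h \<oplus>\<^bsub>A\<^esub> g \<otimes>\<^bsub>A\<^esub> h) s"
      using s by (subst R.finsum_addf) (auto simp: mult_A case_prod_unfold)
    finally show "((f \<oplus>\<^bsub>A\<^esub> g) \<otimes>\<^bsub>A\<^esub> h) s = (f \<otimes>\<^bsub>A\<^esub> h \<oplus>\<^bsub>A\<^esub> g \<otimes>\<^bsub>A\<^esub> h) s" .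
  qed auto
  show ?right
  proof (rule A_eqI)
    fix s assume s: "s \<in> carrier S"
    have "(h \<otimes>\<^bsub>A\<^esub> (f \<oplus>\<^bsub>A\<^esub> g)) s
        = (\<Oplus>q\<in>S.factorizations s. h (fst q) \<otimes> \<omega> (fst q) (f (snd q))
            \<oplus> h (fst q) \<otimes> \<omega> (fst q) (g (snd q)))"
      unfolding mult_A[OF h A_closed(3)[OF f g] s] case_prod_unfold
      by (rule R.finsum_cong') (auto simp: R.r_distr)
    also have "\<dots> = (h \<otimes>\<^bsub>A\<^esub> f \<oplus>\<^bsub>A\<^esub> h \<otimes>\<^bsub>A\<^esub> g) s"
      using s by (subst R.finsum_addf) (auto simp: mult_A case_prod_unfold)
    finally show "(h \<otimes>\<^bsub>A\<^esub> (f \<oplus>\<^bsub>A\<^esub> g)) s = (h \<otimes>\<^bsub>A\<^esub> f \<oplus>\<^bsub>A\<^esub> h \<otimes>\<^bsub>A\<^esub> g) s" .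
  qed auto
qed

lemma ring_A: "ring A"
proof (rule ringI)
  show "abelian_group A"
  proof (rule abelian_groupI)
    fix f assume f: "f \<in> carrier A"
    have "(\<lambda>s\<in>carrier S. \<ominus> f s) \<in> carrier A"
      using f by (auto simp: carrier_A)
    moreover from this have "(\<lambda>s\<in>carrier S. \<ominus> f s) \<oplus>\<^bsub>A\<^esub> f = \<zero>\<^bsub>A\<^esub>"
      using f by (intro A_eqI) (auto simp: R.l_neg)
    ultimately show "\<exists>g\<in>carrier A. g \<oplus>\<^bsub>A\<^esub> f = \<zero>\<^bsub>A\<^esub>" by blast
  qed (auto intro!: A_eqI simp: R.a_ac)
  show "monoid A"
    by (rule monoidI) (auto simp: A_assoc A_one_left A_one_right)
qed (auto simp: A_distrib)

section \<open>Units\<close>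

text \<open>The equation \<open>(f \<otimes> g) s = \<one> s\<close> contains \<open>g s\<close> only in the term \<open>f \<one> \<otimes> g s\<close>; as \<open>\<one>\<close> is the
  least element of \<open>S\<close>, the other terms involve \<open>g v\<close> for \<open>v\<close> below \<open>s\<close> only. The coefficients of
  \<open>g\<close> are thus found by well-founded recursion.\<close>

lemma right_inverse_exists:
  assumes f: "f \<in> carrier A" and unit: "f \<one>\<^bsub>S\<^esub> \<in> Units R"
  obtains g where "g \<in> carrier A" "f \<otimes>\<^bsub>A\<^esub> g = \<one>\<^bsub>A\<^esub>"
proof -
  let ?r = "f \<one>\<^bsub>S\<^esub>"
  let ?T = "\<lambda>s. {(u, v) \<in> S.factorizations s. u \<noteq> \<one>\<^bsub>S\<^esub>}"
  \<comment> \<open>\<open>g s\<close> solved from the equation for \<open>(f \<otimes> g) s\<close>\<close>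
  define step where "step g s =
    inv ?r \<otimes> (\<one>\<^bsub>A\<^esub> s \<ominus> finsum R (\<lambda>(u, v). f u \<otimes> \<omega> u (g v)) (?T s))" for g s
  define g where "g = wfrec (leS - Id) step"
  have T_less: "S.less v s" if "(u, v) \<in> ?T s" for u v s
    using that S.less_mult_if_not_one by (auto simp: S.in_factorizations)
  have T_fin: "finite (?T s)" for s
    by (rule finite_subset[OF _ S.finite_factorizations[of s]]) auto
  have inv_r: "inv ?r \<in> carrier R" using unit by simp
  have g_rec: "g s = step (cut g (leS - Id) s) s" for s
    unfolding g_def by (rule wfrec[OF S.wf_less])
  have cut_terms: "f u \<otimes> \<omega> u (cut g (leS - Id) s v) = f u \<otimes> \<omega> u (g v)"
    if "(u, v) \<in> ?T s" for u v s
    using T_less[OF that] by (simp add: cut_apply)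
  have g_closed: "s \<in> carrier S \<Longrightarrow> g s \<in> carrier R" for s
  proof (induction s rule: wf_induct_rule[OF S.wf_less])
    case (1 s)
    have "finsum R (\<lambda>(u, v). f u \<otimes> \<omega> u (cut g (leS - Id) s v)) (?T s) \<in> carrier R"
    proof (rule R.finsum_closed, rule Pi_I)
      fix x assume x: "x \<in> ?T s"
      obtain u v where uv: "x = (u, v)" by force
      have "u \<in> carrier S" "v \<in> carrier S" using x uv by (auto simp: S.in_factorizations)
      then show "(case x of (u, v) \<Rightarrow> f u \<otimes> \<omega> u (cut g (leS - Id) s v)) \<in> carrier R"
        using x uv f cut_terms[of u v s] "1.IH"[OF T_less[of u v s]] by auto
    qed
    then show ?case
      unfolding g_rec[of s] step_def using inv_r 1(2) by simp
  qed
  have g_eq: "g s = step g s" if s: "s \<in> carrier S" for s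
  proof -
    have "finsum R (\<lambda>(u, v). f u \<otimes> \<omega> u (cut g (leS - Id) s v)) (?T s)
        = finsum R (\<lambda>(u, v). f u \<otimes> \<omega> u (g v)) (?T s)"
      using f g_closed cut_terms by (intro R.finsum_cong') (auto simp: S.in_factorizations)
    then show ?thesis unfolding g_rec[of s] step_def by simp
  qed
  define G where "G = restrict g (carrier S)"
  have G: "G \<in> carrier A" using g_closed by (auto simp: G_def carrier_A)
  have "f \<otimes>\<^bsub>A\<^esub> G = \<one>\<^bsub>A\<^esub>"
  proof (rule A_eqI)
    fix s assume s: "s \<in> carrier S"
    let ?h = "\<lambda>(u, v). f u \<otimes> \<omega> u (g v)"
    have h: "?h \<in> ?T s \<rightarrow> carrier R" using f g_closed by (auto simp: S.in_factorizations)
    have "(f \<otimes>\<^bsub>A\<^esub> G) s = finsum R ?h (S.factorizations s)"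
      unfolding mult_A[OF f G s] using f g_closed
      by (intro R.finsum_cong') (auto simp: S.in_factorizations G_def)
    also have "S.factorizations s = insert (\<one>\<^bsub>S\<^esub>, s) (?T s)"
      using s by (auto simp: S.in_factorizations)
    also have "finsum R ?h \<dots> = ?r \<otimes> g s \<oplus> finsum R ?h (?T s)"
      using s f h T_fin g_closed by (subst R.finsum_insert) auto
    also have "?r \<otimes> g s = \<one>\<^bsub>A\<^esub> s \<ominus> finsum R ?h (?T s)"
    proof -
      have X: "\<one>\<^bsub>A\<^esub> s \<ominus> finsum R ?h (?T s) \<in> carrier R" using s h by simp
      show ?thesis
        unfolding g_eq[OF s] step_def
        using X unit inv_r R.m_assoc[of ?r "inv ?r", symmetric] R.Units_closed[OF unit] by simp
    qed
    also have "\<dots> \<oplus> finsum R ?h (?T s) = \<one>\<^bsub>A\<^esub> s"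
      using s h by (simp add: a_minus_def R.a_assoc R.l_neg)
    finally show "(f \<otimes>\<^bsub>A\<^esub> G) s = \<one>\<^bsub>A\<^esub> s" .
  qed (use f G in auto)
  with G that show ?thesis by blast
qed

text \<open>The right inverse \<open>g\<close> of \<open>f\<close> again has a unit as coefficient at \<open>\<one>\<close>, hence has a right
  inverse itself, which must be \<open>f\<close>.\<close>

lemma Units_A_if_coeff_one_unit:
  assumes f: "f \<in> carrier A" and unit: "f \<one>\<^bsub>S\<^esub> \<in> Units R"
  shows "f \<in> Units A"
proof -
  interpret A: ring A by (rule ring_A)
  obtain g where g: "g \<in> carrier A" "f \<otimes>\<^bsub>A\<^esub> g = \<one>\<^bsub>A\<^esub>"
    using right_inverse_exists[OF assms] .
  have "(f \<otimes>\<^bsub>A\<^esub> g) (\<one>\<^bsub>S\<^esub> \<otimes>\<^bsub>S\<^esub> \<one>\<^bsub>S\<^esub>) = f \<one>\<^bsub>S\<^esub> \<otimes> \<omega> \<one>\<^bsub>S\<^esub> (g \<one>\<^bsub>S\<^esub>)"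
    by (rule leading_term(1)) (use f g S.not_less_one in blast)+
  then have "f \<one>\<^bsub>S\<^esub> \<otimes> g \<one>\<^bsub>S\<^esub> = \<one>" using g by simp
  then have "g \<one>\<^bsub>S\<^esub> = inv (f \<one>\<^bsub>S\<^esub>)"
    using unit g(1) by (metis A_apply R.Units_closed R.Units_l_inv R.Units_inv_closed R.l_one
        R.m_assoc R.r_one S.one_closed)
  then have "g \<one>\<^bsub>S\<^esub> \<in> Units R" using unit by simp
  then obtain h where h: "h \<in> carrier A" "g \<otimes>\<^bsub>A\<^esub> h = \<one>\<^bsub>A\<^esub>"
    using right_inverse_exists g(1) by blast
  have "h = f" using f g h by (metis A.l_one A.m_assoc A.r_one)
  then show ?thesis using f g h unfolding Units_def by blast
qed

lemma least_support_element:
  assumes f: "f \<in> carrier A" and "f \<noteq> \<zero>\<^bsub>A\<^esub>"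
  obtains p where "p \<in> carrier S" "f p \<noteq> \<zero>" "\<And>x. S.less x p \<Longrightarrow> f x = \<zero>"
proof -
  have "\<exists>s. s \<in> gsupp S R f"
    using assms A_eqI[OF f A_closed(1)] by (auto simp: gsupp_def)
  then obtain p where "p \<in> gsupp S R f" "\<And>x. S.less x p \<Longrightarrow> x \<notin> gsupp S R f"
    using wfE_min[OF S.wf_less] by metis
  then show ?thesis
    using that S.less_carrier unfolding gsupp_def by blast
qed

end

section \<open>Coefficients in a domain\<close>

locale skew_series_domain = skew_series R S leS \<omega> + R: nc_domain R
  for R :: "('r, 'm) ring_scheme" (structure) and S :: "('s, 'n) monoid_scheme" (structure)
    and leS :: "'s rel" and \<omega> :: "'s \<Rightarrow> 'r \<Rightarrow> 'r" +
  assumes omega_inj: "s \<in> carrier S \<Longrightarrow> inj_on (\<omega> s) (carrier R)"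
begin

lemma omega_nonzero: "\<lbrakk>s \<in> carrier S; r \<in> carrier R; r \<noteq> \<zero>\<rbrakk> \<Longrightarrow> \<omega> s r \<noteq> \<zero>"
  using inj_onD[OF omega_inj, of s r \<zero>] by auto

lemma leading_coeff_nonzero:
  assumes "f \<in> carrier A" "g \<in> carrier A" "p \<in> carrier S" "q \<in> carrier S"
    and "f p \<noteq> \<zero>" "g q \<noteq> \<zero>"
  shows "f p \<otimes> \<omega> p (g q) \<noteq> \<zero>"
  using assms R.integral[of "f p" "\<omega> p (g q)"] omega_nonzero[of p "g q"] by auto

lemma nc_domain_A: "nc_domain A"
proof -
  interpret A: ring A by (rule ring_A)
  show ?thesis
  proof
    have "\<one>\<^bsub>A\<^esub> \<one>\<^bsub>S\<^esub> \<noteq> \<zero>\<^bsub>A\<^esub> \<one>\<^bsub>S\<^esub>" using R.one_not_zero by simp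
    then show "\<one>\<^bsub>A\<^esub> \<noteq> \<zero>\<^bsub>A\<^esub>" by metis
  next
    fix f g assume f: "f \<in> carrier A" and g: "g \<in> carrier A" and fg: "f \<otimes>\<^bsub>A\<^esub> g = \<zero>\<^bsub>A\<^esub>"
    show "f = \<zero>\<^bsub>A\<^esub> \<or> g = \<zero>\<^bsub>A\<^esub>"
    proof (rule ccontr)
      assume "\<not> (f = \<zero>\<^bsub>A\<^esub> \<or> g = \<zero>\<^bsub>A\<^esub>)"
      then have nz: "f \<noteq> \<zero>\<^bsub>A\<^esub>" "g \<noteq> \<zero>\<^bsub>A\<^esub>" by auto
      obtain p where p: "p \<in> carrier S" "f p \<noteq> \<zero>" "\<And>x. S.less x p \<Longrightarrow> f x = \<zero>"
        using least_support_element[OF f nz(1)] by metis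
      obtain q where q: "q \<in> carrier S" "g q \<noteq> \<zero>" "\<And>x. S.less x q \<Longrightarrow> g x = \<zero>"
        using least_support_element[OF g nz(2)] by metis
      have "(f \<otimes>\<^bsub>A\<^esub> g) (p \<otimes>\<^bsub>S\<^esub> q) \<noteq> \<zero>"
        using leading_term(1)[OF f g p(1,3) q(1,3)] leading_coeff_nonzero[OF f g] p q by simp
      then show False using fg p q by simp
    qed
  qed
qed

text \<open>Let \<open>g \<noteq> \<zero>\<close> lie in all \<open>f [^] n \<otimes> A\<close>, with cofactors \<open>h n = f \<otimes> h (Suc n)\<close>, and let \<open>s\<close> and
  \<open>q n\<close> be the least elements of the supports of \<open>f\<close> and \<open>h n\<close>. Then \<open>q n = s \<otimes> q (Suc n)\<close>. If
  \<open>s \<noteq> \<one>\<close>, then \<open>s\<close> is above \<open>\<one>\<close> and the \<open>q n\<close> strictly decrease, which is impossible. If \<open>s = \<one>\<close>,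
  all \<open>q n\<close> agree, and the coefficient of \<open>g\<close> there is divisible by all powers of \<open>f \<one>\<close>, which is
  a nonunit of \<open>R\<close>.\<close>

lemma right_archimedean_A:
  assumes arch: "right_archimedean R"
  shows "right_archimedean A"
  unfolding right_archimedean_def
proof
  interpret A: nc_domain A by (rule nc_domain_A)
  fix f assume "f \<in> carrier A - Units A"
  then have f: "f \<in> carrier A" and nonunit: "f \<one>\<^bsub>S\<^esub> \<notin> Units R"
    using Units_A_if_coeff_one_unit by auto
  have "g = \<zero>\<^bsub>A\<^esub>" if g: "g \<in> (\<Inter>n::nat. (f [^]\<^bsub>A\<^esub> n) <#\<^bsub>A\<^esub> carrier A)" for g
  proof (rule ccontr)
    assume g0: "g \<noteq> \<zero>\<^bsub>A\<^esub>"
    \<comment> \<open>\<open>g\<close> is a multiple of \<open>f\<close> itself\<close>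
    have "g \<in> (f [^]\<^bsub>A\<^esub> (1::nat)) <#\<^bsub>A\<^esub> carrier A" using g by blast
    then have f0: "f \<noteq> \<zero>\<^bsub>A\<^esub>"
      using g0 f by (auto simp: l_coset_def)
    obtain h where h: "h 0 = g" "\<And>n :: nat. h n \<in> carrier A" "\<And>n. h n = f \<otimes>\<^bsub>A\<^esub> h (Suc n)"
      using A.chain_of_cofactors[OF f f0 g] by blast
    have h0: "h n \<noteq> \<zero>\<^bsub>A\<^esub>" for n
    proof (induction n)
      case 0
      show ?case using h(1) g0 by simp
    next
      case (Suc n)
      then show ?case using h(3)[of n] f by auto
    qed
    obtain s where s: "s \<in> carrier S" "f s \<noteq> \<zero>" "\<And>x. S.less x s \<Longrightarrow> f x = \<zero>"
      using least_support_element[OF f f0] by metis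
    have "\<forall>n. \<exists>q. q \<in> carrier S \<and> h n q \<noteq> \<zero> \<and> (\<forall>x. S.less x q \<longrightarrow> h n x = \<zero>)"
      using least_support_element[OF h(2) h0] by metis
    then obtain q where q: "q n \<in> carrier S" "h n (q n) \<noteq> \<zero>"
      "\<And>x. S.less x (q n) \<Longrightarrow> h n x = \<zero>" for n by metis
    have lead_coeff: "h n (s \<otimes>\<^bsub>S\<^esub> q (Suc n)) = f s \<otimes> \<omega> s (h (Suc n) (q (Suc n)))" for n
      by (subst h(3)[of n], rule leading_term(1)) (use f h(2) s q in blast)+
    have vanish_below: "h n z = \<zero>" if "S.less z (s \<otimes>\<^bsub>S\<^esub> q (Suc n))" for n z
      by (subst h(3)[of n], rule leading_term(2)[where p = s and q = "q (Suc n)"])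
        (use that f h(2) s q in blast)+
    have q_rec: "q n = s \<otimes>\<^bsub>S\<^esub> q (Suc n)" for n
    proof -
      have sq: "s \<otimes>\<^bsub>S\<^esub> q (Suc n) \<in> carrier S" using s q by simp
      have "h n (s \<otimes>\<^bsub>S\<^esub> q (Suc n)) \<noteq> \<zero>"
        using lead_coeff[of n] leading_coeff_nonzero[OF f h(2) s(1) q(1) s(2) q(2)] by simp
      then have "\<not> S.less (s \<otimes>\<^bsub>S\<^esub> q (Suc n)) (q n)" using q(3) by blast
      moreover have "\<not> S.less (q n) (s \<otimes>\<^bsub>S\<^esub> q (Suc n))"
        using vanish_below q(2) by blast
      ultimately show ?thesis using S.less_cases[OF q(1) sq] by blast
    qed
    show False
    proof (cases "s = \<one>\<^bsub>S\<^esub>")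
      case False
      have "S.less (q (Suc n)) (q n)" for n
        using S.less_mult_if_not_one[OF s(1) q(1)[of "Suc n"] False] q_rec[of n] by simp
      then show False
        using S.wf_less unfolding wf_iff_no_infinite_down_chain by blast
    next
      case True
      let ?r = "f \<one>\<^bsub>S\<^esub>"
      have r: "?r \<in> carrier R - Units R" using f nonunit by simp
      have q_const: "q n = q 0" for n
      proof (induction n)
        case (Suc n)
        then show ?case using q_rec[of n] True q(1) by simp
      qed simp
      have step: "h n (q 0) = ?r \<otimes> h (Suc n) (q 0)" for n
        using lead_coeff[of n] True q(1) q_const[of "Suc n"] h(2) by simp
      have "g (q 0) = ?r [^] n \<otimes> h n (q 0)" for n :: nat
      proof (induction n)
        case 0
        show ?case using h(1,2) q(1) by (metis A_apply R.l_one R.nat_pow_0)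
      next
        case (Suc n)
        then show ?case
          using step[of n] r h(2) q(1) by (simp add: R.m_assoc)
      qed
      then have "g (q 0) \<in> (\<Inter>n::nat. (?r [^] n) <# carrier R)"
        using A_apply[OF h(2) q(1)] unfolding l_coset_def by blast
      then have "g (q 0) = \<zero>"
        using arch r unfolding right_archimedean_def by blast
      then show False using q(2)[of 0] h(1) by simp
    qed
  qed
  moreover have "\<zero>\<^bsub>A\<^esub> \<in> (f [^]\<^bsub>A\<^esub> n) <#\<^bsub>A\<^esub> carrier A" for n :: nat
    unfolding l_coset_def using A.r_null[OF A.nat_pow_closed[OF f], of n] A_closed(1) by blast
  ultimately show "(\<Inter>n::nat. (f [^]\<^bsub>A\<^esub> n) <#\<^bsub>A\<^esub> carrier A) = {\<zero>\<^bsub>A\<^esub>}" by blast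
qed

end

theorem theorem3p1:
  fixes R :: "('r, 'm) ring_scheme"
    and S :: "('s, 'n) monoid_scheme"
    and leS :: "'s rel"
    and \<omega> :: "'s \<Rightarrow> 'r \<Rightarrow> 'r"
  assumes "nc_domain R" and "right_archimedean R"
    and "strictly_totally_ordered_monoid S leS" and "artinian_on (carrier S) leS"
    and "\<omega> \<in> monoid_hom S (End_monoid R)"
    and "\<And>s. s \<in> carrier S \<Longrightarrow> inj_on (\<omega> s) (carrier R)"
    and "\<And>s r. \<lbrakk>s \<in> carrier S; r \<in> carrier R - Units R\<rbrakk> \<Longrightarrow> \<omega> s r \<in> carrier R - Units R"
  shows "nc_domain (skew_gps S leS R \<omega>) \<and> right_archimedean (skew_gps S leS R \<omega>)"
proof -
  interpret skew_series_domain R S leS \<omega>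
    using assms
    by (intro skew_series_domain.intro skew_series.intro well_ordered_monoid.intro
        well_ordered_monoid_axioms.intro skew_series_axioms.intro skew_series_domain_axioms.intro
        nc_domain.axioms(1)) auto
  show ?thesis
    using nc_domain_A right_archimedean_A[OF assms(2)] by blast
qed

end
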